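(* For every $\lambda<1$ and every odd positive integer $D$, there exists $\lambda'<1$ (depending only on $\lambda$ and $D$) such that for every $N$, if $G$ is an $(N,D,\lambda)$-graph and $C$ is the cycle on $D$ vertices, then the replacement product of $G$ (as the large graph) with $C$ (as the small graph) is an $(ND,3,\lambda')$-graph.
   Context: For a positive integer $n$, $[n]=\{1,\dots,n\}$. Graphs are finite, undirected and regular, and may have self-loops and parallel edges. A $D$-regular graph $G$ on $[N]$ is specified by its rotation map $\mathrm{Rot}_G:[N]\times[D]\to[N]\times[D]$: $\mathrm{Rot}_G(v,i)=(w,j)$ means that the $i$-th edge incident to $v$ leads to $w$ and that this edge is the $j$-th edge incident to $w$. Thus $\mathrm{Rot}_G$ is a permutation with $\mathrm{Rot}_G\circ\mathrm{Rot}_G=\mathrm{id}$ (and any such involution specifies a $D$-regular graph). Vertex sets and sets of edge labels may be any finite sets of the right cardinality. The cycle $C$ is the 2-regular graph on $[D]$ in which $i$ is joined to $i\pm1$ modulo $D$ (with any edge labeling). The normalized adjacency matrix of $G$ is the symmetric $N\times N$ matrix with $M_{u,v}=\frac1D|\{(i,j)\in[D]^2:\mathrm{Rot}_G(u,i)=(v,j)\}|$. The second largest eigenvalue in absolute value is $\lambda(G)=\max_{\alpha\perp 1_N,\,\alpha\ne0}\|M\alpha\|/\|\alpha\|$, where $1_N$ is the all-ones vector and the norm is Euclidean (with $\lambda(G)=0$ if $N=1$). An $(N,D,\lambda)$-graph is a $D$-regular graph on $N$ vertices with $\lambda(G)\le\lambda$. Replacement product: for a $D_1$-regular graph $G_1$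 on $[N_1]$ (the large graph) and a $D_2$-regular graph $G_2$ on $[D_1]$ (the small graph), it is the $(D_2+1)$-regular graph on $[N_1]\times[D_1]$ whose rotation map on input $((v,k),i)$ is: if $i\le D_2$, let $(m,j)=\mathrm{Rot}_{G_2}(k,i)$ and output $((v,m),j)$; if $i=D_2+1$, output $(\mathrm{Rot}_{G_1}(v,k),i)$. *)

theory Defs
  imports "HOL-Analysis.Analysis" "HOL-Number_Theory.Cong"
begin

text \<open>
  A \<open>D\<close>-regular graph on a finite vertex set \<open>V\<close> is given by its rotation map
  \<open>rot\<close>, where \<open>rot (v, i) = (w, j)\<close> means that the \<open>i\<close>-th edge at \<open>v\<close> leads to \<open>w\<close>
  and is the \<open>j\<close>-th edge at \<open>w\<close>. Edge labels are the numbers from \<open>1\<close> to \<open>D\<close>; values of \<open>rot\<close>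
  outside \<open>V \<times> {1..D}\<close> are irrelevant. Self-loops (including fixed points of \<open>rot\<close>)
  and parallel edges are allowed.
\<close>

type_synonym 'v rotation = "'v \<times> nat \<Rightarrow> 'v \<times> nat"

definition regular_graph :: "'v set \<Rightarrow> nat \<Rightarrow> 'v rotation \<Rightarrow> bool" where
  "regular_graph V D rot \<longleftrightarrow>
     finite V \<and> V \<noteq> {} \<and> 0 < D \<and>
     (\<forall>x \<in> V \<times> {1..D}. rot x \<in> V \<times> {1..D} \<and> rot (rot x) = x)"

definition norm_adj :: "nat \<Rightarrow> 'v rotation \<Rightarrow> 'v \<Rightarrow> 'v \<Rightarrow> real" where
  "norm_adj D rot u v =
     real (card {(i, j). i \<in> {1..D} \<and> j \<in> {1..D} \<and> rot (u, i) = (v, j)}) / real D"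

definition adj_apply :: "'v set \<Rightarrow> nat \<Rightarrow> 'v rotation \<Rightarrow> ('v \<Rightarrow> real) \<Rightarrow> 'v \<Rightarrow> real" where
  "adj_apply V D rot \<alpha> u = (\<Sum>v\<in>V. norm_adj D rot u v * \<alpha> v)"

text \<open>
  Vectors are functions of which only the values on \<open>V\<close> matter, and \<open>L2_set \<alpha> V\<close> is the
  Euclidean norm. For at least two vertices the set below is nonempty and bounded, and its
  supremum is attained (by compactness of the unit sphere), so it is the maximum.
\<close>

definition second_eigenvalue :: "'v set \<Rightarrow> nat \<Rightarrow> 'v rotation \<Rightarrow> real" where
  "second_eigenvalue V D rot =
     (if card V = 1 then 0
      else Sup {L2_set (adj_apply V D rot \<alpha>) V / L2_set \<alpha> V | \<alpha>.
                  (\<Sum>v\<in>V. \<alpha> v) = 0 \<and> (\<exists>v\<in>V. \<alpha> v \<noteq> 0)})"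

definition expander_graph ::
    "nat \<Rightarrow> nat \<Rightarrow> real \<Rightarrow> 'v set \<Rightarrow> 'v rotation \<Rightarrow> bool" where
  "expander_graph N D lam V rot \<longleftrightarrow>
     regular_graph V D rot \<and> card V = N \<and> second_eigenvalue V D rot \<le> lam"

text \<open>
  The cycle on \<open>{1..D}\<close> with an arbitrary edge labelling. When \<open>k + 1\<close> and \<open>k - 1\<close> agree
  modulo \<open>D\<close> (that is, \<open>D \<le> 2\<close>), the right-hand set is a singleton and the equation makes
  both edges at \<open>k\<close> lead to that vertex; so equality of sets is here the same as equality
  of multisets.
\<close>

definition cycle_graph :: "nat \<Rightarrow> nat rotation \<Rightarrow> bool" where
  "cycle_graph D rot \<longleftrightarrow>
     regular_graph {1..D} 2 rot \<and>
     (\<forall>k\<in>{1..D}. {fst (rot (k, 1)), fst (rot (k, 2))} =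
        {m \<in> {1..D}. [int m = int k + 1] (mod int D) \<or> [int m = int k - 1] (mod int D)})"

text \<open>
  \<open>D2\<close> is the degree of the small graph \<open>rot2\<close>, whose vertices are the edge labels
  of the large graph \<open>rot1\<close>. The last case is meant for \<open>i = D2 + 1\<close>.
\<close>

fun replacement_product ::
    "'v rotation \<Rightarrow> nat \<Rightarrow> nat rotation \<Rightarrow> ('v \<times> nat) rotation" where
  "replacement_product rot1 D2 rot2 ((v, k), i) =
     (if i \<le> D2 then (let (m, j) = rot2 (k, i) in ((v, m), j))
      else (rot1 (v, k), i))"

end

theory Submission
  imports Defs
begin

text \<open>
  Let \<open>A\<close> and \<open>B\<close> be the normalized adjacency operators of the large graph's edges (a
  permutation) and of the copies of the cycle, so that the product acts as \<open>M = (2 B + A) / 3\<close>.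
  By the parallelogram law the loss \<open>\<parallel>\<alpha>\<parallel>\<^sup>2 - \<parallel>M \<alpha>\<parallel>\<^sup>2\<close> is a positive combination of
  \<open>\<parallel>B \<alpha> - A \<alpha>\<parallel>\<^sup>2\<close> and of the sum of all \<open>(\<alpha> (v, k + 1) - \<alpha> (v, k - 1))\<^sup>2\<close>.
  If both are small, then \<open>\<alpha>\<close> is nearly constant on each copy of the cycle, because
  steps of length two connect an odd cycle. Hence \<open>B \<alpha>\<close> is close to \<open>\<alpha>\<close>, so the vector \<open>\<beta>\<close>
  of averages over the copies nearly satisfies \<open>G \<beta> = \<beta>\<close>, and the spectral gap of \<open>G\<close> forces
  \<open>\<beta>\<close>, and with it \<open>\<alpha>\<close>, to be small.
\<close>

section \<open>Rotation maps and the averaging operator of a graph\<close>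

lemma regular_graphD:
  assumes "regular_graph V D rot"
  shows "finite V" "V \<noteq> {}" "0 < D"
    "\<And>v i. v \<in> V \<Longrightarrow> i \<in> {1..D} \<Longrightarrow> rot (v, i) \<in> V \<times> {1..D}"
    "\<And>v i. v \<in> V \<Longrightarrow> i \<in> {1..D} \<Longrightarrow> rot (rot (v, i)) = (v, i)"
  using assms unfolding regular_graph_def by auto

lemma sum_rot:
  assumes "regular_graph V D rot"
  shows "(\<Sum>x\<in>V \<times> {1..D}. f (rot x)) = (\<Sum>x\<in>V \<times> {1..D}. f x)"
  using assms unfolding regular_graph_def
  by (intro sum.reindex_bij_witness[of _ rot rot]) blast+

text \<open>Since \<open>rot\<close> permutes the pairs \<open>(v, i)\<close>, each vertex is
  reached by exactly \<open>D\<close> of them. This is the double stochasticity of the adjacency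
  matrix.\<close>

lemma sum_neighbours:
  fixes f :: "'v \<Rightarrow> real"
  assumes "regular_graph V D rot"
  shows "(\<Sum>v\<in>V. \<Sum>i=1..D. f (fst (rot (v, i)))) = real D * (\<Sum>v\<in>V. f v)"
proof -
  have "(\<Sum>v\<in>V. \<Sum>i=1..D. f (fst (rot (v, i)))) = (\<Sum>x\<in>V \<times> {1..D}. f (fst (rot x)))"
    by (simp add: sum.cartesian_product)
  also have "\<dots> = (\<Sum>x\<in>V \<times> {1..D}. f (fst x))"
    by (rule sum_rot[OF assms])
  also have "\<dots> = (\<Sum>v\<in>V. \<Sum>i=1..D. f v)"
    by (subst sum.cartesian_product') simp
  finally show ?thesis
    by (simp add: sum_distrib_left)
qed

text \<open>A pair \<open>(i, j)\<close> counted by \<open>norm_adj\<close> is determined by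
  \<open>i\<close>, because \<open>j = snd (rot (u, i))\<close> is forced. So the matrix averages
  over the labels at \<open>u\<close>, which is the form used in the estimates below.\<close>

lemma adj_apply_eq_sum:
  assumes "regular_graph V D rot" "u \<in> V"
  shows "adj_apply V D rot f u = (\<Sum>i=1..D. f (fst (rot (u, i)))) / real D"
proof -
  note G = regular_graphD[OF assms(1)]
  have "real (card {(i, j). i \<in> {1..D} \<and> j \<in> {1..D} \<and> rot (u, i) = (v, j)})
      = (\<Sum>i=1..D. if fst (rot (u, i)) = v then 1 else 0)" for v
  proof -
    have "snd (rot (u, i)) \<in> {1..D}" if "i \<in> {1..D}" for i
      using G(4)[OF assms(2) that] by (simp add: mem_Times_iff)
    then have "{(i, j). i \<in> {1..D} \<and> j \<in> {1..D} \<and> rot (u, i) = (v, j)}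
        = (\<lambda>i. (i, snd (rot (u, i)))) ` {i \<in> {1..D}. fst (rot (u, i)) = v}"
      by (force simp: prod_eq_iff)
    then have "card {(i, j). i \<in> {1..D} \<and> j \<in> {1..D} \<and> rot (u, i) = (v, j)}
        = card {i \<in> {1..D}. fst (rot (u, i)) = v}"
      by (simp only:) (intro card_image inj_onI, simp)
    then show ?thesis
      by (simp only:) (simp add: sum.If_cases Int_def)
  qed
  then have "adj_apply V D rot f u
      = (\<Sum>v\<in>V. (\<Sum>i=1..D. if fst (rot (u, i)) = v then f v else 0) / real D)"
    unfolding adj_apply_def norm_adj_def
    by (simp add: sum_distrib_right if_distrib[of "\<lambda>x. x * _"] cong: if_cong)
  also have "\<dots> = (\<Sum>i=1..D. \<Sum>v\<in>V. if fst (rot (u, i)) = v then f v else 0) / real D"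
    by (simp only: sum_divide_distrib[symmetric]) (subst sum.swap, simp)
  also have "\<dots> = (\<Sum>i=1..D. f (fst (rot (u, i)))) / real D"
    using G(1) G(4)[OF assms(2)] by (intro arg_cong[of _ _ "\<lambda>x. x / real D"] sum.cong)
       (auto simp: mem_Times_iff)
  finally show ?thesis .
qed

lemma sum_squared_le_card:
  fixes f :: "'a \<Rightarrow> real"
  shows "(\<Sum>i\<in>A. f i)\<^sup>2 \<le> real (card A) * (\<Sum>i\<in>A. (f i)\<^sup>2)"
  using Cauchy_Schwarz_ineq_sum[of "\<lambda>_. 1" f A] by simp

text \<open>By Cauchy-Schwarz the square of an average is at most the average of the squares, and
  summing over \<open>V\<close> counts each value \<open>D\<close> times. The contraction also shows
  that the set in \<open>second_eigenvalue\<close> is bounded above.\<close>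

lemma L2_set_adj_apply_le:
  assumes "regular_graph V D rot"
  shows "L2_set (adj_apply V D rot f) V \<le> L2_set f V"
proof -
  note G = regular_graphD[OF assms]
  have "(adj_apply V D rot f u)\<^sup>2 \<le> (\<Sum>i=1..D. (f (fst (rot (u, i))))\<^sup>2) / real D"
    if "u \<in> V" for u
    using G(3) sum_squared_le_card[of "\<lambda>i. f (fst (rot (u, i)))" "{1..D}"]
    by (simp add: adj_apply_eq_sum[OF assms that] power_divide divide_simps power2_eq_square mult.commute)
  then have "(\<Sum>u\<in>V. (adj_apply V D rot f u)\<^sup>2)
      \<le> (\<Sum>u\<in>V. (\<Sum>i=1..D. (f (fst (rot (u, i))))\<^sup>2) / real D)"
    by (rule sum_mono)
  also have "\<dots> = (\<Sum>u\<in>V. (f u)\<^sup>2)"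
    using G(3) sum_neighbours[OF assms, of "\<lambda>v. (f v)\<^sup>2"]
    by (simp flip: sum_divide_distrib)
  finally show ?thesis
    unfolding L2_set_def by (rule real_sqrt_le_mono)
qed

section \<open>The second eigenvalue as an operator bound on vectors of sum zero\<close>

lemma L2_set_adj_apply_le_second_eigenvalue:
  assumes "regular_graph V D rot" "(\<Sum>v\<in>V. f v) = 0"
  shows "L2_set (adj_apply V D rot f) V \<le> second_eigenvalue V D rot * L2_set f V"
proof (cases "\<exists>v\<in>V. f v \<noteq> 0")
  case False
  then have "L2_set f V = 0"
    by (simp add: L2_set_def)
  with L2_set_adj_apply_le[OF assms(1), of f] show ?thesis
    by simp
next
  case True
  let ?S = "{L2_set (adj_apply V D rot \<alpha>) V / L2_set \<alpha> V | \<alpha>.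
      (\<Sum>v\<in>V. \<alpha> v) = 0 \<and> (\<exists>v\<in>V. \<alpha> v \<noteq> 0)}"
  note G = regular_graphD[OF assms(1)]
  \<comment> \<open>A nonzero vector of sum zero lives on at least two vertices, so
    \<open>second_eigenvalue\<close> is given by its \<open>Sup\<close> case.\<close>
  have "card V \<noteq> 1"
    using True assms(2) by (auto simp: card_1_singleton_iff)
  moreover have "x \<le> 1" if "x \<in> ?S" for x
    using that L2_set_adj_apply_le[OF assms(1)]
    by (auto intro!: divide_le_eq_1[THEN iffD2] simp: L2_set_nonneg less_le)
  then have "bdd_above ?S"
    by (rule bdd_aboveI)
  then have "L2_set (adj_apply V D rot f) V / L2_set f V \<le> Sup ?S"
    using assms(2) True by (intro cSup_upper) auto
  moreover have "L2_set f V > 0"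
    using True G(1) L2_set_nonneg[of f V] by (auto simp: less_le L2_set_eq_0_iff)
  ultimately show ?thesis
    by (simp add: second_eigenvalue_def pos_divide_le_eq)
qed

lemma second_eigenvalue_le:
  assumes "finite V" "V \<noteq> {}" "0 \<le> c"
    and "\<And>f. (\<Sum>v\<in>V. f v) = 0 \<Longrightarrow> L2_set (adj_apply V D rot f) V \<le> c * L2_set f V"
  shows "second_eigenvalue V D rot \<le> c"
proof (cases "card V = 1")
  case True
  then show ?thesis
    using assms(3) by (simp add: second_eigenvalue_def)
next
  case False
  let ?S = "{L2_set (adj_apply V D rot \<alpha>) V / L2_set \<alpha> V | \<alpha>.
      (\<Sum>v\<in>V. \<alpha> v) = 0 \<and> (\<exists>v\<in>V. \<alpha> v \<noteq> 0)}"
  obtain a where a: "a \<in> V"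
    using assms(2) by auto
  obtain b where b: "b \<in> V" "b \<noteq> a"
    using False a is_singletonI'[of V] by (auto simp: is_singleton_altdef)
  \<comment> \<open>A nonzero vector of sum zero, so that the supremum is over a nonempty set, as
    \<open>cSup_least\<close> requires.\<close>
  define f :: "'a \<Rightarrow> real" where "f = (\<lambda>v. (if v = a then 1 else 0) - (if v = b then 1 else 0))"
  have "(\<Sum>v\<in>V. f v) = 0" "f a \<noteq> 0"
    using assms(1) a b by (simp_all add: f_def sum_subtractf)
  with a have "?S \<noteq> {}"
    by blast
  moreover have "x \<le> c" if x: "x \<in> ?S" for x
  proof -
    obtain g v where g: "x = L2_set (adj_apply V D rot g) V / L2_set g V"
        "(\<Sum>v\<in>V. g v) = 0" "v \<in> V" "g v \<noteq> 0"
      using x by blast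
    then have "L2_set g V > 0"
      using assms(1) L2_set_nonneg[of g V] by (auto simp: less_le L2_set_eq_0_iff)
    then show ?thesis
      using assms(4)[OF g(2)] g(1) by (simp add: pos_divide_le_eq)
  qed
  ultimately have "Sup ?S \<le> c"
    by (rule cSup_least)
  with False show ?thesis
    by (simp add: second_eigenvalue_def)
qed

text \<open>Triangle inequality for \<open>f = (f - G f) + G f\<close>. This is the form in which
  the expansion of the large graph is used: a vector of sum zero that is almost fixed by the graph
  is small.\<close>

lemma L2_set_le_gap:
  assumes "regular_graph V D rot" "second_eigenvalue V D rot \<le> lam" "(\<Sum>v\<in>V. f v) = 0"
  shows "(1 - lam) * L2_set f V \<le> L2_set (\<lambda>v. f v - adj_apply V D rot f v) V"
proof -
  have "L2_set f V \<le> L2_set (\<lambda>v. f v - adj_apply V D rot f v) V + L2_set (adj_apply V D rot f) V"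
    using L2_set_triangle_ineq[of "\<lambda>v. f v - adj_apply V D rot f v" "adj_apply V D rot f" V] by simp
  also have "L2_set (adj_apply V D rot f) V \<le> lam * L2_set f V"
    using L2_set_adj_apply_le_second_eigenvalue[OF assms(1,3)] assms(2)
    by (meson L2_set_nonneg mult_right_mono order_trans)
  finally show ?thesis
    by (simp add: algebra_simps)
qed

section \<open>Oscillation of functions on an odd cycle\<close>

text \<open>The two neighbours of a vertex differ by a step of length two, and each such step
  changes \<open>f\<close> by at most the norm on the right. For odd \<open>D\<close> the number 2
  is invertible modulo \<open>D\<close>, so fewer than \<open>D\<close> such steps lead from
  \<open>k\<close> to \<open>j\<close>.\<close>

lemma cycle_graph_oscillation:
  fixes f :: "nat \<Rightarrow> real"
  assumes "cycle_graph D rot" "odd D" "j \<in> {1..D}" "k \<in> {1..D}"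
  shows "\<bar>f j - f k\<bar> \<le> real D * L2_set (\<lambda>m. f (fst (rot (m, 1))) - f (fst (rot (m, 2)))) {1..D}"
    (is "_ \<le> _ * ?h")
proof -
  \<comment> \<open>The periodic extension of \<open>f\<close>, shifted by one because the vertices
    are numbered from 1: vertex \<open>k\<close> is read at position \<open>k - 1\<close>.\<close>
  define F where "F n = f (n mod D + 1)" for n
  have D: "D > 0"
    using assms(2) by (cases D) auto
  have step: "\<bar>F (n + 2) - F n\<bar> \<le> ?h" for n
  proof -
    \<comment> \<open>The vertex \<open>?c\<close> lies between \<open>?y\<close> and
      \<open>?x\<close>. Which label leads to which of them is unknown, but the absolute value does
      not see the order.\<close>
    let ?c = "(n + 1) mod D + 1" and ?x = "(n + 2) mod D + 1" and ?y = "n mod D + 1"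
    have in_range: "i mod D + 1 \<in> {1..D}" for i
      using D by (simp add: Suc_leI)
    have "[int ?x = int ?c + 1] (mod int D)" "[int ?y = int ?c - 1] (mod int D)"
      by (simp_all add: cong_def zmod_int mod_simps algebra_simps)
    then have "?x \<in> {fst (rot (?c, 1)), fst (rot (?c, 2))}" "?y \<in> {fst (rot (?c, 1)), fst (rot (?c, 2))}"
      using assms(1) in_range unfolding cycle_graph_def by auto
    then have "\<bar>F (n + 2) - F n\<bar> \<le> \<bar>f (fst (rot (?c, 1))) - f (fst (rot (?c, 2)))\<bar>"
      unfolding F_def by auto
    also have "\<dots> \<le> ?h"
      using member_le_L2_set[OF _ in_range, of "\<lambda>m. \<bar>f (fst (rot (m, 1))) - f (fst (rot (m, 2)))\<bar>" "n + 1"]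
      by (simp add: L2_set_def)
    finally show ?thesis .
  qed
  have steps: "\<bar>F (n + 2 * m) - F n\<bar> \<le> real m * ?h" for n m
  proof (induction m)
    case (Suc m)
    then show ?case
      using step[of "n + 2 * m"] by (simp add: algebra_simps)
  qed simp
  have "coprime 2 D"
    using assms(2) by simp
  then obtain t where t: "[2 * t = 1] (mod D)"
    using cong_solve_coprime_nat[of 2 D] by auto
  \<comment> \<open>With \<open>t\<close> the inverse of 2, this solves \<open>2 * m = j - k\<close>
    modulo \<open>D\<close>; adding \<open>D\<close> avoids truncated subtraction, and reducing
    modulo \<open>D\<close> keeps the number of steps below \<open>D\<close>.\<close>
  define m where "m = (t * (j + (D - k))) mod D"
  have "[(k - 1) + 2 * m = (k - 1) + (2 * t) * (j + (D - k))] (mod D)"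
    unfolding m_def cong_def by (metis (no_types) mod_add_right_eq mod_mult_right_eq mult.assoc)
  also have "[(k - 1) + (2 * t) * (j + (D - k)) = (k - 1) + 1 * (j + (D - k))] (mod D)"
    using t by (intro cong_add cong_mult) auto
  also have "(k - 1) + 1 * (j + (D - k)) = (j - 1) + D"
    using assms(3,4) by auto
  finally have "((k - 1) + 2 * m) mod D = j - 1"
    using assms(3) by (simp add: cong_def) (subst mod_less, auto)
  then have "F ((k - 1) + 2 * m) = f j" "F (k - 1) = f k"
    using assms(3,4) unfolding F_def by auto
  with steps[of "k - 1" m] have "\<bar>f j - f k\<bar> \<le> real m * ?h"
    by simp
  also have "\<dots> \<le> real D * ?h"
    using D by (intro mult_right_mono L2_set_nonneg) (simp add: m_def less_imp_le)
  finally show ?thesis .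
qed

text \<open>The deviation of \<open>f k\<close> from the mean is the average of the differences
  \<open>f k - f j\<close>, each of which the oscillation bound controls.\<close>

lemma cycle_graph_poincare:
  fixes f :: "nat \<Rightarrow> real"
  assumes "cycle_graph D rot" "odd D" "k \<in> {1..D}"
  shows "(f k - (\<Sum>j=1..D. f j) / D)\<^sup>2
    \<le> (real D)\<^sup>2 * (\<Sum>m=1..D. (f (fst (rot (m, 1))) - f (fst (rot (m, 2))))\<^sup>2)"
proof -
  let ?h = "L2_set (\<lambda>m. f (fst (rot (m, 1))) - f (fst (rot (m, 2)))) {1..D}"
  have D: "D > 0"
    using assms(2) by (cases D) auto
  have "\<bar>\<Sum>j=1..D. f k - f j\<bar> \<le> (\<Sum>j=1..D. \<bar>f k - f j\<bar>)"
    by (rule sum_abs)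
  also have "\<dots> \<le> (\<Sum>j=1..D. real D * ?h)"
    using assms by (intro sum_mono cycle_graph_oscillation)
  finally have "\<bar>real D * f k - (\<Sum>j=1..D. f j)\<bar> \<le> real D * (real D * ?h)"
    by (simp add: sum_subtractf)
  moreover have "real D * f k - (\<Sum>j=1..D. f j) = real D * (f k - (\<Sum>j=1..D. f j) / D)"
    using D by (simp add: field_simps)
  ultimately have "\<bar>f k - (\<Sum>j=1..D. f j) / D\<bar> \<le> real D * ?h"
    using D by (simp add: abs_mult)
  then have "(f k - (\<Sum>j=1..D. f j) / D)\<^sup>2 \<le> (real D * ?h)\<^sup>2"
    by (rule abs_le_square_iff[THEN iffD1, OF order_trans]) simp
  then show ?thesis
    by (simp add: power_mult_distrib L2_set_def sum_nonneg)
qed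

section \<open>The replacement product and its spectral gap\<close>

lemma regular_graph_replacement_product:
  assumes "regular_graph V D rot1" "regular_graph {1..D} D2 rot2"
  shows "regular_graph (V \<times> {1..D}) (D2 + 1) (replacement_product rot1 D2 rot2)"
proof -
  note G = regular_graphD[OF assms(1)] and C = regular_graphD[OF assms(2)]
  let ?R = "replacement_product rot1 D2 rot2"
  have "?R ((v, k), i) \<in> (V \<times> {1..D}) \<times> {1..D2 + 1} \<and> ?R (?R ((v, k), i)) = ((v, k), i)"
    if v: "v \<in> V" and k: "k \<in> {1..D}" and i: "i \<in> {1..D2 + 1}" for v k i
  proof (cases "i \<le> D2")
    case True
    then have "i \<in> {1..D2}"
      using i by simp
    from C(4,5)[OF k this] v True show ?thesis
      by (auto split: prod.splits)
  next
    case False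
    have "?R ((v, k), i) = (rot1 (v, k), i)"
      using False by simp
    moreover have "?R (rot1 (v, k), i) = (rot1 (rot1 (v, k)), i)"
      using False by (cases "rot1 (v, k)") simp
    ultimately show ?thesis
      using G(4,5)[OF v k] i by simp
  qed
  then show ?thesis
    using G(1,2,3) unfolding regular_graph_def by (auto simp del: replacement_product.simps)
qed

text \<open>Labels 1 and 2 stay in the copy of the cycle and label 3 follows \<open>rot1\<close>.
  The vertices of the product are exactly the pairs that \<open>rot1\<close> permutes, so the last
  term is \<open>f\<close> composed with a permutation of the vertices.\<close>

lemma adj_apply_replacement_product:
  assumes "regular_graph V D rot1" "regular_graph {1..D} 2 rot2" "v \<in> V" "k \<in> {1..D}"
  shows "adj_apply (V \<times> {1..D}) 3 (replacement_product rot1 2 rot2) f (v, k)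
    = (f (v, fst (rot2 (k, 1))) + f (v, fst (rot2 (k, 2))) + f (rot1 (v, k))) / 3"
proof -
  have "{1..3::nat} = {1, 2, 3}"
    by auto
  moreover have "regular_graph (V \<times> {1..D}) 3 (replacement_product rot1 2 rot2)"
    using regular_graph_replacement_product[OF assms(1,2)] by simp
  ultimately show ?thesis
    using assms(3,4) by (simp add: adj_apply_eq_sum split_def Let_def)
qed

text \<open>The operator loses \<open>H / 6 + 2 * Q / 9\<close> of the squared norm
  \<open>S\<close>, and the proof shows that \<open>S\<close> is at most \<open>K\<close> times this
  loss. As \<open>K\<close> depends only on \<open>D\<close> and \<open>lam\<close>, the bound is
  uniform in \<open>V\<close>.\<close>

lemma L2_set_adj_apply_replacement_product_le:
  fixes lam :: real and V :: "'v set"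
  assumes G: "regular_graph V D rotG" "second_eigenvalue V D rotG \<le> lam" "lam < 1"
    and C: "cycle_graph D rotC" "odd D"
    and f: "(\<Sum>x\<in>V \<times> {1..D}. f x) = 0"
  defines "K \<equiv> 12 * real D ^ 3 + (18 + 24 * real D ^ 3) / (1 - lam)\<^sup>2"
  shows "L2_set (adj_apply (V \<times> {1..D}) 3 (replacement_product rotG 2 rotC) f) (V \<times> {1..D})
    \<le> sqrt (1 - 1 / K) * L2_set f (V \<times> {1..D})"
proof -
  let ?E = "V \<times> {1..D}"
  let ?M = "adj_apply ?E 3 (replacement_product rotG 2 rotC) f"
  have C2: "regular_graph {1..D} 2 rotC"
    using C(1) by (simp add: cycle_graph_def)
  note GD = regular_graphD[OF G(1)]
  have D: "real D > 0" using GD(3) by simp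
  \<comment> \<open>Here \<open>(p x + q x) / 2\<close> is the value of \<open>B f\<close> and
    \<open>f (rotG x)\<close> that of \<open>A f\<close>, so \<open>r\<close> is
    \<open>B f - A f\<close>. The vector \<open>f\<close> splits into the averages \<open>b\<close>
    over the copies and the deviations \<open>d\<close>.\<close>
  define p where "p x = f (fst x, fst (rotC (snd x, 1)))" for x
  define q where "q x = f (fst x, fst (rotC (snd x, 2)))" for x
  define r where "r x = (p x + q x) / 2 - f (rotG x)" for x
  define H where "H = (\<Sum>x\<in>?E. (p x - q x)\<^sup>2)"
  define Q where "Q = (\<Sum>x\<in>?E. (r x)\<^sup>2)"
  define S where "S = (\<Sum>x\<in>?E. (f x)\<^sup>2)"
  define b where "b v = (\<Sum>k=1..D. f (v, k)) / D" for v
  define d where "d x = f x - b (fst x)" for x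
  \<comment> \<open>Within a copy each vertex is a cycle neighbour twice. This is used for squares,
    to compute norms, and for the identity, to compute averages.\<close>
  have pq: "(\<Sum>k=1..D. g (p (v, k)) + g (q (v, k))) = 2 * (\<Sum>k=1..D. g (f (v, k)))"
    for g :: "real \<Rightarrow> real" and v
  proof -
    have "{1..2::nat} = {1, 2}"
      by auto
    then show ?thesis
      using sum_neighbours[OF C2, of "\<lambda>k. g (f (v, k))"] by (simp add: p_def q_def)
  qed
  have pq2: "(\<Sum>x\<in>?E. (p x)\<^sup>2 + (q x)\<^sup>2) = 2 * S"
    using pq[of "\<lambda>t. t\<^sup>2"]
    by (simp add: S_def sum.cartesian_product' sum_distrib_left)
  \<comment> \<open>The parallelogram law twice: for the weights 2/3 and 1/3 of \<open>B f\<close>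
    and \<open>A f\<close>, whose product is the 2/9, and for the mean of \<open>p x\<close> and
    \<open>q x\<close>.\<close>
  have "(?M x)\<^sup>2 = (1/3) * ((p x)\<^sup>2 + (q x)\<^sup>2) + (1/3) * (f (rotG x))\<^sup>2
      - (1/6) * (p x - q x)\<^sup>2 - (2/9) * (r x)\<^sup>2" if "x \<in> ?E" for x
  proof -
    have M: "?M x = (p x + q x + f (rotG x)) / 3"
      using that adj_apply_replacement_product[OF G(1) C2] by (auto simp: p_def q_def)
    show ?thesis
      unfolding M r_def by (simp add: power2_eq_square field_simps)
  qed
  then have "(\<Sum>x\<in>?E. (?M x)\<^sup>2) = (\<Sum>x\<in>?E. (1/3) * ((p x)\<^sup>2 + (q x)\<^sup>2) + (1/3) * (f (rotG x))\<^sup>2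
      - (1/6) * (p x - q x)\<^sup>2 - (2/9) * (r x)\<^sup>2)"
    by (rule sum.cong[OF refl])
  also have "\<dots> = (1/3) * (2 * S) + (1/3) * (\<Sum>x\<in>?E. (f (rotG x))\<^sup>2) - (1/6) * H - (2/9) * Q"
    unfolding pq2[symmetric] H_def Q_def
    by (simp only: sum.distrib sum_subtractf sum_distrib_left[symmetric])
  also have "(\<Sum>x\<in>?E. (f (rotG x))\<^sup>2) = S"
    unfolding S_def by (rule sum_rot[OF G(1)])
  finally have loss: "(\<Sum>x\<in>?E. (?M x)\<^sup>2) = S - (H / 6 + 2 * Q / 9)"
    by simp
  have HQ: "H \<ge> 0" "Q \<ge> 0"
    by (simp_all add: H_def Q_def sum_nonneg)

  \<comment> \<open>The cycle inequality gives a factor \<open>D^2\<close> at each of the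
    \<open>D\<close> vertices of a copy, hence the cube.\<close>
  have "(\<Sum>x\<in>?E. (d x)\<^sup>2) \<le> (\<Sum>v\<in>V. \<Sum>k=1..D. (real D)\<^sup>2 * (\<Sum>m=1..D. (p (v, m) - q (v, m))\<^sup>2))"
    unfolding sum.cartesian_product' d_def b_def p_def q_def fst_conv snd_conv
    by (intro sum_mono cycle_graph_poincare[OF C, of _ "\<lambda>k. f (_, k)"])
  also have "\<dots> = real D ^ 3 * H"
    by (simp add: H_def sum.cartesian_product' sum_distrib_left power3_eq_cube power2_eq_square ac_simps)
  finally have d_le: "(\<Sum>x\<in>?E. (d x)\<^sup>2) \<le> real D ^ 3 * H" .

  have gap: "real D * (b v - adj_apply V D rotG b v)\<^sup>2
      \<le> (\<Sum>k=1..D. 2 * (r (v, k))\<^sup>2 + 2 * (d (rotG (v, k)))\<^sup>2)" if v: "v \<in> V" for v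
  proof -
    \<comment> \<open>Summed over one copy, the cycle part contributes \<open>D * b v\<close>.
      Replacing \<open>f (rotG x)\<close> by the average over its copy costs
      \<open>d (rotG x)\<close>, and these averages add up to \<open>D\<close> times the value of
      \<open>G b\<close> at \<open>v\<close>.\<close>
    have "(\<Sum>k=1..D. r (v, k) + d (rotG (v, k)))
        = (\<Sum>k=1..D. p (v, k) + q (v, k)) / 2 - (\<Sum>k=1..D. b (fst (rotG (v, k))))"
      by (simp add: r_def d_def sum.distrib sum_subtractf flip: sum_divide_distrib)
    also have "\<dots> = real D * (b v - adj_apply V D rotG b v)"
      using pq[of "\<lambda>t. t" v] D by (simp add: adj_apply_eq_sum[OF G(1) v] b_def field_simps)
    finally have "(real D * (b v - adj_apply V D rotG b v))\<^sup>2
        \<le> real D * (\<Sum>k=1..D. (r (v, k) + d (rotG (v, k)))\<^sup>2)"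
      using sum_squared_le_card[of "\<lambda>k. r (v, k) + d (rotG (v, k))" "{1..D}"] by simp
    then have "real D * (b v - adj_apply V D rotG b v)\<^sup>2 \<le> (\<Sum>k=1..D. (r (v, k) + d (rotG (v, k)))\<^sup>2)"
      using D by (simp add: power_mult_distrib power2_eq_square[of "real D"] mult.assoc)
    also have "\<dots> \<le> (\<Sum>k=1..D. 2 * (r (v, k))\<^sup>2 + 2 * (d (rotG (v, k)))\<^sup>2)"
    proof (rule sum_mono)
      fix k
      show "(r (v, k) + d (rotG (v, k)))\<^sup>2 \<le> 2 * (r (v, k))\<^sup>2 + 2 * (d (rotG (v, k)))\<^sup>2"
        using sum_squares_bound[of "r (v, k)" "d (rotG (v, k))"] by (simp add: power2_sum)
    qed
    finally show ?thesis .
  qed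
  have "real D * (\<Sum>v\<in>V. (b v - adj_apply V D rotG b v)\<^sup>2)
      \<le> (\<Sum>v\<in>V. \<Sum>k=1..D. 2 * (r (v, k))\<^sup>2 + 2 * (d (rotG (v, k)))\<^sup>2)"
    unfolding sum_distrib_left by (intro sum_mono gap)
  also have "\<dots> = 2 * Q + 2 * (\<Sum>x\<in>?E. (d (rotG x))\<^sup>2)"
    by (simp add: Q_def sum.cartesian_product' sum.distrib sum_distrib_left)
  also have "(\<Sum>x\<in>?E. (d (rotG x))\<^sup>2) = (\<Sum>x\<in>?E. (d x)\<^sup>2)"
    by (rule sum_rot[OF G(1)])
  finally have gap_sum: "real D * (\<Sum>v\<in>V. (b v - adj_apply V D rotG b v)\<^sup>2) \<le> 2 * Q + 2 * (real D ^ 3 * H)"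
    using d_le by linarith

  have "(\<Sum>v\<in>V. b v) = 0"
    using f by (simp add: b_def sum.cartesian_product' flip: sum_divide_distrib)
  from L2_set_le_gap[OF G(1,2) this]
  have "((1 - lam) * L2_set b V)\<^sup>2 \<le> (L2_set (\<lambda>v. b v - adj_apply V D rotG b v) V)\<^sup>2"
    using G(3) by (intro power_mono) (auto simp: L2_set_nonneg)
  then have "(1 - lam)\<^sup>2 * (\<Sum>v\<in>V. (b v)\<^sup>2) \<le> (\<Sum>v\<in>V. (b v - adj_apply V D rotG b v)\<^sup>2)"
    by (simp add: L2_set_def power_mult_distrib sum_nonneg)
  then have "real D * ((1 - lam)\<^sup>2 * (\<Sum>v\<in>V. (b v)\<^sup>2)) \<le> 2 * Q + 2 * (real D ^ 3 * H)"
    using D gap_sum by (meson mult_left_mono less_imp_le order_trans)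
  then have b_le: "real D * (\<Sum>v\<in>V. (b v)\<^sup>2) \<le> (2 * Q + 2 * (real D ^ 3 * H)) / (1 - lam)\<^sup>2"
    using G(3) by (simp add: field_simps)

  have "S \<le> (\<Sum>x\<in>?E. 2 * (d x)\<^sup>2 + 2 * (b (fst x))\<^sup>2)"
    unfolding S_def
  proof (rule sum_mono)
    fix x
    have "f x = d x + b (fst x)"
      by (simp add: d_def)
    then show "(f x)\<^sup>2 \<le> 2 * (d x)\<^sup>2 + 2 * (b (fst x))\<^sup>2"
      using sum_squares_bound[of "d x" "b (fst x)"] by (simp add: power2_sum)
  qed
  also have "\<dots> = 2 * (\<Sum>x\<in>?E. (d x)\<^sup>2) + 2 * (real D * (\<Sum>v\<in>V. (b v)\<^sup>2))"
    by (simp add: sum.cartesian_product' sum.distrib sum_distrib_left ac_simps)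
  also have "\<dots> \<le> 2 * (real D ^ 3 * H) + 2 * ((2 * Q + 2 * (real D ^ 3 * H)) / (1 - lam)\<^sup>2)"
    using d_le b_le by linarith
  also have "\<dots> \<le> K * (H / 6 + 2 * Q / 9)"
  proof -
    \<comment> \<open>Origin of \<open>K\<close>: the coefficient \<open>2 * P + 4 * P / g\<close>
      of \<open>H\<close> must be at most \<open>K / 6\<close>, and the coefficient
      \<open>4 / g\<close> of \<open>Q\<close> at most \<open>2 * K / 9\<close>. The sum of the two
      resulting lower bounds for \<open>K\<close> serves both; the right-hand side is the
      surplus.\<close>
    have "(12 * P + (18 + 24 * P) / g) * (H / 6 + 2 * Q / 9)
          - (2 * (P * H) + 2 * ((2 * Q + 2 * (P * H)) / g))
        = (8 / 3) * (P * Q) + (3 * H + (16 / 3) * (P * Q)) / g" if "g > 0" for P g :: real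
      using that by (simp add: field_simps)
    from this[of "(1 - lam)\<^sup>2" "real D ^ 3"]
    have "K * (H / 6 + 2 * Q / 9) - (2 * (real D ^ 3 * H) + 2 * ((2 * Q + 2 * (real D ^ 3 * H)) / (1 - lam)\<^sup>2))
        = (8 / 3) * (real D ^ 3 * Q) + (3 * H + (16 / 3) * (real D ^ 3 * Q)) / (1 - lam)\<^sup>2"
      using G(3) by (simp only: K_def) simp
    moreover have "\<dots> \<ge> 0"
      using HQ D by (intro add_nonneg_nonneg divide_nonneg_nonneg mult_nonneg_nonneg) auto
    ultimately show ?thesis
      by linarith
  qed
  finally have "S \<le> K * (H / 6 + 2 * Q / 9)" .
  moreover have "K > 0"
    using D unfolding K_def by (intro add_pos_nonneg) auto
  ultimately have "(\<Sum>x\<in>?E. (?M x)\<^sup>2) \<le> (1 - 1 / K) * S"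
    unfolding loss by (simp add: field_simps)
  then show ?thesis
    unfolding L2_set_def S_def real_sqrt_mult[symmetric] by (rule real_sqrt_le_mono)
qed

theorem corollary6p5:
  fixes lam :: real and D :: nat
  assumes "lam < 1" and "odd D"
  shows "\<exists>lam'::real. lam' < 1 \<and>
    (\<forall>(N::nat) (rotG :: nat rotation) (rotC :: nat rotation).
       expander_graph N D lam {1..N} rotG \<and> cycle_graph D rotC \<longrightarrow>
       expander_graph (N * D) 3 lam' ({1..N} \<times> {1..D}) (replacement_product rotG 2 rotC))"
proof -
  \<comment> \<open>With \<open>K \<ge> 1\<close> the number \<open>1 - 1 / K\<close> lies between 0
    and 1, with 1 excluded, so its square root is a nonnegative bound below 1. It is fixed before
    \<open>N\<close> and the rotation maps are chosen.\<close>
  define K where "K = 12 * real D ^ 3 + (18 + 24 * real D ^ 3) / (1 - lam)\<^sup>2"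
  have "real D \<ge> 1"
    using assms(2) by (cases D) auto
  then have "real D ^ 3 \<ge> 1"
    by simp
  moreover have "(18 + 24 * real D ^ 3) / (1 - lam)\<^sup>2 \<ge> 0"
    by simp
  ultimately have K: "K \<ge> 1"
    unfolding K_def by linarith
  have "expander_graph (N * D) 3 (sqrt (1 - 1 / K)) ({1..N} \<times> {1..D}) (replacement_product rotG 2 rotC)"
    if "expander_graph N D lam {1..N} rotG" "cycle_graph D rotC" for N rotG rotC
  proof -
    have G: "regular_graph {1..N} D rotG" "second_eigenvalue {1..N} D rotG \<le> lam"
      using that(1) by (simp_all add: expander_graph_def)
    have "regular_graph {1..D} 2 rotC"
      using that(2) by (simp add: cycle_graph_def)
    then have R: "regular_graph ({1..N} \<times> {1..D}) 3 (replacement_product rotG 2 rotC)"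
      using regular_graph_replacement_product[OF G(1)] by fastforce
    moreover have "second_eigenvalue ({1..N} \<times> {1..D}) 3 (replacement_product rotG 2 rotC) \<le> sqrt (1 - 1 / K)"
      using L2_set_adj_apply_replacement_product_le[OF G assms(1) that(2) assms(2)] K
      by (intro second_eigenvalue_le regular_graphD[OF R]) (simp_all add: K_def)
    ultimately show ?thesis
      by (simp add: expander_graph_def)
  qed
  moreover have "sqrt (1 - 1 / K) < 1"
    using K by simp
  ultimately show ?thesis
    by blast
qed

end
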